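(* Let $r\ge 0$ be an integer and $\mu_r\in\mathbb{R}$, $\mu_r\ne 0$. Let ${\mathcal D}^{t(n)}(\mu_r;r)$ be the union of the Gershgorin intervals of the $n\times n$ Jacobi matrix of $\{P^t_k(\mu_r;r)\}_{k\ge0}$. Then: \begin{enumerate} \item For $r=0$: \begin{enumerate} \item For $n=1$: ${\mathcal D}^{t(1)}(\mu_0;0)=\{\mu_0\}$. \item For $n=2$: if $-1\le\mu_0<0$, then ${\mathcal D}^{t(2)}(\mu_0;0)=[\mu_0-\frac12,\frac12]$; if $0<\mu_0\le1$, then ${\mathcal D}^{t(2)}(\mu_0;0)=[-\frac12,\mu_0+\frac12]$; if $\mu_0>1$ or $\mu_0<-1$, then $[-\frac12,\frac12]\cap[\mu_0-\frac12,\mu_0+\frac12]=\emptyset$, there is one zero of $P^t_2(\mu_0;0)$ in $[\mu_0-\frac12,\mu_0+\frac12]$ and the other one is in $[-\frac12,\frac12]$. \item For $n\ge3$: if $-\frac32\le\mu_0\le-\frac12$, then ${\mathcal D}^{t(n)}(\mu_0;0)=[\mu_0-\frac12,1]$; if $-\frac12\le\mu_0\le\frac12$, then ${\mathcal D}^{t(n)}(\mu_0;0)=[-1,1]$; if $\frac12\le\mu_0\le\frac32$, then ${\mathcal D}^{t(n)}(\mu_0;0)=[-1,\mu_0+\frac12]$; if $\mu_0>\frac32$ or $\mu_0<-\frac32$, then $[-1,1]\cap[\mu_0-\frac12,\mu_0+\frac12]=\emptyset$, there is a unique zero of $P^t_n(\mu_0;0)$ in $[\mu_0-\frac12,\mu_0+\frac12]$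 and the other ones are in $[-1,1]$. \end{enumerate} \item For $r=1$: \begin{enumerate} \item For $n=2$: if $-1\le\mu_1<0$, then ${\mathcal D}^{t(2)}(\mu_1;1)=[\mu_1-\frac12,\frac12]$; if $0<\mu_1\le1$, then ${\mathcal D}^{t(2)}(\mu_1;1)=[-\frac12,\mu_1+\frac12]$; if $\mu_1>1$ or $\mu_1<-1$, then $[-\frac12,\frac12]\cap[\mu_1-\frac12,\mu_1+\frac12]=\emptyset$, there is one zero of $P^t_2(\mu_1;1)$ in $[\mu_1-\frac12,\mu_1+\frac12]$ and the other one is in $[-\frac12,\frac12]$. \item For $n=3$: if $-\frac32\le\mu_1\le-\frac12$, then ${\mathcal D}^{t(3)}(\mu_1;1)=[\mu_1-1,\frac12]$; if $-\frac12\le\mu_1\le\frac12$, then ${\mathcal D}^{t(3)}(\mu_1;1)=[\mu_1-1,\mu_1+1]$; if $\frac12\le\mu_1\le\frac32$, then ${\mathcal D}^{t(3)}(\mu_1;1)=[-\frac12,\mu_1+1]$; if $\mu_1>\frac32$ or $\mu_1<-\frac32$, then $[-\frac12,\frac12]\cap[\mu_1-1,\mu_1+1]=\emptyset$, there is a unique zero of $P^t_3(\mu_1;1)$ in $[\mu_1-1,\mu_1+1]$ and the other ones are in $[-\frac12,\frac12]$. \item For $n\ge4$: if $-2\le\mu_1<0$, then ${\mathcal D}^{t(n)}(\mu_1;1)=[\mu_1-1,1]$; if $0<\mu_1\le2$, then ${\mathcal D}^{t(n)}(\mu_1;1)=[-1,\mu_1+1]$; if $\mu_1>2$ or $\mu_1<-2$,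 then $[-1,1]\cap[\mu_1-1,\mu_1+1]=\emptyset$, there is a unique zero of $P^t_n(\mu_1;1)$ in $[\mu_1-1,\mu_1+1]$ and the other ones are in $[-1,1]$. \end{enumerate} \item For $r\ge2$: \begin{enumerate} \item For $n=r+1$: if $-\frac32\le\mu_r\le-\frac12$, then ${\mathcal D}^{t(n)}(\mu_r;r)=[\mu_r-\frac12,1]$; if $-\frac12\le\mu_r\le\frac12$, then ${\mathcal D}^{t(n)}(\mu_r;r)=[-1,1]$; if $\frac12\le\mu_r\le\frac32$, then ${\mathcal D}^{t(n)}(\mu_r;r)=[-1,\mu_r+\frac12]$; if $\mu_r>\frac32$ or $\mu_r<-\frac32$, then $[-1,1]\cap[\mu_r-\frac12,\mu_r+\frac12]=\emptyset$, there is a unique zero of $P^t_n(\mu_r;r)$ in $[\mu_r-\frac12,\mu_r+\frac12]$ and the other ones are in $[-1,1]$. \item For $n\ge r+2$: if $-2\le\mu_r<0$, then ${\mathcal D}^{t(n)}(\mu_r;r)=[\mu_r-1,1]$; if $0<\mu_r\le2$, then ${\mathcal D}^{t(n)}(\mu_r;r)=[-1,\mu_r+1]$; if $\mu_r>2$ or $\mu_r<-2$, then $[-1,1]\cap[\mu_r-1,\mu_r+1]=\emptyset$, there is a unique zero of $P^t_n(\mu_r;r)$ in $[\mu_r-1,\mu_r+1]$ and the other ones are in $[-1,1]$. \end{enumerate} \end{enumerate}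
   Context: For an integer $r\ge 0$ and $\mu_r\in\mathbb{R}$, the $r$th-perturbed by translation sequence $\{P^t_n(\mu_r;r)\}_{n\ge 0}$ of the monic Chebyshev polynomials of the second kind is the monic sequence with $P^t_0=1$, $P^t_1(x)=x-\beta_0$, $P^t_{n+2}(x)=(x-\beta_{n+1})P^t_{n+1}(x)-\frac14P^t_n(x)$ for $n\ge 0$, where $\beta_r=\mu_r$ and $\beta_n=0$ for $n\ne r$. Its $n\times n$ Jacobi matrix is the real symmetric tridiagonal matrix with diagonal entries $\beta_0,\dots,\beta_{n-1}$ and all sub- and super-diagonal entries equal to $\frac12$; $P^t_n(\mu_r;r)$ is its characteristic polynomial, and its eigenvalues are real. For a real symmetric matrix $A=(a_{ij})_{1\le i,j\le n}$ the Gershgorin intervals are $[a_{ii}-\rho_i,a_{ii}+\rho_i]$, $1\le i\le n$, with $\rho_i=\sum_{j\ne i}|a_{ij}|$ (a single point if $\rho_i=0$). *)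

theory Defs
  imports "HOL-Computational_Algebra.Polynomial" "Jordan_Normal_Form.Matrix"
begin

definition pert_beta :: "nat \<Rightarrow> real \<Rightarrow> nat \<Rightarrow> real" where
  "pert_beta r \<mu> n = (if n = r then \<mu> else 0)"

fun pert_cheb :: "nat \<Rightarrow> real \<Rightarrow> nat \<Rightarrow> real poly" where
  "pert_cheb r \<mu> 0 = 1"
| "pert_cheb r \<mu> (Suc 0) = [:- pert_beta r \<mu> 0, 1:]"
| "pert_cheb r \<mu> (Suc (Suc n)) =
     [:- pert_beta r \<mu> (Suc n), 1:] * pert_cheb r \<mu> (Suc n) - Polynomial.smult (1/4) (pert_cheb r \<mu> n)"

definition pert_jacobi :: "nat \<Rightarrow> real \<Rightarrow> nat \<Rightarrow> real mat" where
  "pert_jacobi r \<mu> n = mat n n (\<lambda>(i, j).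
     if i = j then pert_beta r \<mu> i
     else if i = Suc j \<or> j = Suc i then 1/2
     else 0)"

definition gershgorin_radius :: "real mat \<Rightarrow> nat \<Rightarrow> real" where
  "gershgorin_radius A i = (\<Sum>j \<in> {..<dim_col A} - {i}. \<bar>A $$ (i, j)\<bar>)"

definition gershgorin_interval :: "real mat \<Rightarrow> nat \<Rightarrow> real set" where
  "gershgorin_interval A i =
     {A $$ (i, i) - gershgorin_radius A i .. A $$ (i, i) + gershgorin_radius A i}"

definition gershgorin_union :: "real mat \<Rightarrow> real set" where
  "gershgorin_union A = (\<Union>i<dim_row A. gershgorin_interval A i)"

abbreviation pert_dom :: "nat \<Rightarrow> real \<Rightarrow> nat \<Rightarrow> real set" where
  "pert_dom r \<mu> n \<equiv> gershgorin_union (pert_jacobi r \<mu> n)"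

text \<open>
  Number of real zeros in a set, counted with multiplicity. Since \<open>pert_cheb r \<mu> n\<close> has
  degree \<open>n\<close> (lemma below), one zero in \<open>I\<close> and \<open>n - 1\<close> zeros in a disjoint set \<open>J\<close> are all its
  complex zeros. So these two counts together say that there is a unique zero in \<open>I\<close>, that it is
  simple, and that all other zeros are in \<open>J\<close>.
\<close>

definition zeros_in :: "real poly \<Rightarrow> real set \<Rightarrow> nat" where
  "zeros_in p S = size (filter_mset (\<lambda>x. x \<in> S) (proots p))"

lemma pert_cheb_degree_monic:
  "degree (pert_cheb r \<mu> n) = n \<and> lead_coeff (pert_cheb r \<mu> n) = 1"
proof (induction n rule: less_induct)
  case (less n)
  consider "n = 0" | "n = Suc 0" | k where "n = Suc (Suc k)"
    by (metis not0_implies_Suc)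
  then show ?case
  proof cases
    case 3
    let ?p = "[:- pert_beta r \<mu> (Suc k), 1:] * pert_cheb r \<mu> (Suc k)"
    have q: "degree (pert_cheb r \<mu> (Suc k)) = Suc k" "lead_coeff (pert_cheb r \<mu> (Suc k)) = 1"
      using less.IH[of "Suc k"] 3 by blast+
    have s: "degree (Polynomial.smult (1/4) (pert_cheb r \<mu> k)) = k"
      using less.IH[of k] 3 by simp
    have "pert_cheb r \<mu> (Suc k) \<noteq> 0"
      using q(1) by (metis degree_0 nat.distinct(1))
    then have d: "degree ?p = Suc (Suc k)"
      using q(1) by (subst degree_mult_eq) simp_all
    have l: "lead_coeff ?p = 1"
      using q(2) by (simp only: lead_coeff_mult) simp
    have "degree (?p + - Polynomial.smult (1/4) (pert_cheb r \<mu> k)) = degree ?p"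
      using d s by (intro degree_add_eq_left) simp
    moreover have "coeff (Polynomial.smult (1/4) (pert_cheb r \<mu> k)) (Suc (Suc k)) = 0"
      using s by (intro coeff_eq_0) simp
    ultimately show ?thesis
      unfolding 3 pert_cheb.simps using d l
      by (metis add_uminus_conv_diff coeff_diff diff_zero)
  qed simp_all
qed

end

theory Submission
  imports Defs "Jordan_Normal_Form.Char_Poly" "HOL-Computational_Algebra.Fundamental_Theorem_Algebra"
begin

text \<open>
  All zeros are real because \<open>Im (P\<^sub>k\<^sub>+\<^sub>1(z) * cnj (P\<^sub>k(z)))\<close> stays positive on the upper half
  plane, and simple because the Wronskian of consecutive polynomials stays positive. Off the
  unperturbed intervals, with \<open>U\<^sub>k\<close> the unperturbed polynomials, \<open>R\<^sub>k = U\<^sub>k\<^sub>-\<^sub>1 / U\<^sub>k\<close> and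
  \<open>m = n - r - 1\<close>, one has \<open>P\<^sub>n(x) = U\<^sub>r(x) U\<^sub>m(x) (x - R\<^sub>r(x)/4 - R\<^sub>m(x)/4 - \<mu>)\<close>. There
  \<open>\<bar>R\<^sub>k\<bar> \<le> 2\<close> and \<open>R\<^sub>k\<close> is non-increasing, so the last factor is strictly increasing, vanishes only
  inside the interval around \<open>\<mu>\<close>, and does so exactly once.
\<close>

section \<open>Real and simple zeros\<close>

text \<open>Multiply the recurrence by \<open>cnj (p (Suc k))\<close>. The real coefficients drop
  out of the imaginary part, and swapping the conjugation in the term \<open>p k / 4\<close> flips
  its sign, so both contributions are positive.\<close>

lemma Im_mult_pert_cheb_pos:
  fixes z :: complex and r :: nat and \<mu> :: real
  assumes "Im z > 0"
  defines "p \<equiv> \<lambda>k. poly (map_poly of_real (pert_cheb r \<mu> k)) z"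
  shows "Im (p (Suc k) * cnj (p k)) > 0"
proof (induction k)
  case 0
  show ?case
    using assms(1) by (simp add: p_def map_poly_pCons)
next
  case (Suc k)
  interpret of_real_poly: map_poly_comm_ring_hom complex_of_real ..
  have rec: "p (Suc (Suc k)) = (z - of_real (pert_beta r \<mu> (Suc k))) * p (Suc k) - p k / 4"
    by (simp add: p_def hom_distribs algebra_simps)
  have "p (Suc k) \<noteq> 0"
    using Suc by auto
  then have "Im z * (cmod (p (Suc k)))\<^sup>2 > 0"
    using assms(1) by simp
  moreover have "Im (p (Suc (Suc k)) * cnj (p (Suc k)))
      = Im z * (cmod (p (Suc k)))\<^sup>2 + Im (p (Suc k) * cnj (p k)) / 4"
    unfolding rec cmod_power2 by (simp add: field_simps power2_eq_square)
  ultimately show ?case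
    using Suc by linarith
qed

lemma poly_of_real_cnj:
  "poly (map_poly of_real p) (cnj z) = cnj (poly (map_poly of_real p) z)"
  by (induction p) (simp_all add: map_poly_pCons)

text \<open>A zero would make the product with its conjugated predecessor vanish, so none lies in
  the upper half plane. Conjugation excludes the lower one.\<close>

lemma pert_cheb_complex_root_real:
  fixes z :: complex
  assumes "poly (map_poly of_real (pert_cheb r \<mu> n)) z = 0"
  shows "Im z = 0"
proof (cases n)
  case 0
  then show ?thesis using assms by simp
next
  case (Suc k)
  have "\<not> Im w > 0" if "poly (map_poly of_real (pert_cheb r \<mu> n)) w = 0" for w :: complex
    using Im_mult_pert_cheb_pos[of w r \<mu> k] that Suc by auto
  from this[of z] this[of "cnj z"] assms show ?thesis
    by (simp add: poly_of_real_cnj)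
qed

text \<open>Induction on the degree: the fundamental theorem of algebra supplies a complex zero,
  which is real by hypothesis, and the cofactor of its linear factor inherits the
  hypothesis.\<close>

lemma size_proots_real_rooted:
  fixes p :: "real poly"
  assumes "p \<noteq> 0"
    and "\<And>z :: complex. poly (map_poly of_real p) z = 0 \<Longrightarrow> Im z = 0"
  shows "size (proots p) = degree p"
  using assms
proof (induction "degree p" arbitrary: p)
  case 0
  then show ?case
    by (metis add_cancel_left_right degree_eq_zeroE proots_const size_empty)
next
  case (Suc d)
  interpret of_real_poly: map_poly_comm_ring_hom complex_of_real ..
  have "\<not> constant (poly (map_poly complex_of_real p))"
    using Suc.hyps(2) by (simp add: constant_degree degree_map_poly)
  then obtain z :: complex where z: "poly (map_poly of_real p) z = 0"
    using fundamental_theorem_of_algebra by blast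
  define a where "a = Re z"
  have "z = of_real a"
    using Suc.prems(2)[OF z] by (simp add: a_def complex_eq_iff)
  then have "poly p a = 0"
    using z by simp
  then obtain q where q: "p = [:- a, 1:] * q"
    by (auto simp: poly_eq_0_iff_dvd elim: dvdE)
  have q0: "q \<noteq> 0"
    using Suc.prems(1) q by auto
  have dq: "d = degree q"
    using Suc.hyps(2) q0 unfolding q by (subst (asm) degree_mult_eq) auto
  have "poly (map_poly of_real p) w = poly (map_poly of_real [:- a, 1:]) w * poly (map_poly of_real q) w"
    for w :: complex
    unfolding q by (simp only: of_real_poly.hom_mult poly_mult)
  then have "size (proots q) = degree q"
    using Suc.prems(2) by (intro Suc.hyps(1) dq q0) auto
  then show ?case
    using q0 dq Suc.hyps(2) unfolding q by (subst proots_mult) auto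
qed

lemma pert_cheb_nonzero: "pert_cheb r \<mu> n \<noteq> 0"
  using pert_cheb_degree_monic[of r \<mu> n] by auto

lemma size_proots_pert_cheb: "size (proots (pert_cheb r \<mu> n)) = n"
proof -
  have "size (proots (pert_cheb r \<mu> n)) = degree (pert_cheb r \<mu> n)"
    using pert_cheb_nonzero pert_cheb_complex_root_real by (rule size_proots_real_rooted)
  then show ?thesis
    using pert_cheb_degree_monic[of r \<mu> n] by simp
qed

text \<open>The recurrence turns a Wronskian \<open>W\<close> into \<open>b\<^sup>2 + W / 4\<close>,
  where \<open>b\<close> is the value of the shared polynomial. At a zero of
  \<open>pert_cheb r \<mu> (Suc k)\<close> only the product containing its derivative survives, so
  that derivative cannot vanish there.\<close>

lemma pert_cheb_wronskian_pos:
  "poly (pderiv (pert_cheb r \<mu> (Suc k))) x * poly (pert_cheb r \<mu> k) x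
     - poly (pert_cheb r \<mu> (Suc k)) x * poly (pderiv (pert_cheb r \<mu> k)) x > 0"
proof (induction k)
  case 0
  show ?case by (simp add: pderiv_pCons)
next
  case (Suc k)
  define a where "a = poly (pert_cheb r \<mu> k) x"
  define a' where "a' = poly (pderiv (pert_cheb r \<mu> k)) x"
  define b where "b = poly (pert_cheb r \<mu> (Suc k)) x"
  define b' where "b' = poly (pderiv (pert_cheb r \<mu> (Suc k))) x"
  define c where "c = x - pert_beta r \<mu> (Suc k)"
  have IH: "b' * a - b * a' > 0"
    using Suc by (simp add: a_def a'_def b_def b'_def)
  have step: "poly (pert_cheb r \<mu> (Suc (Suc k))) x = c * b - a / 4"
    "poly (pderiv (pert_cheb r \<mu> (Suc (Suc k)))) x = b + c * b' - a' / 4"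
    by (simp_all add: a_def a'_def b_def b'_def c_def pderiv_diff pderiv_add pderiv_smult
        pderiv_pCons algebra_simps del: mult_pCons_left add: pderiv_mult)
  have "poly (pderiv (pert_cheb r \<mu> (Suc (Suc k)))) x * b
      - poly (pert_cheb r \<mu> (Suc (Suc k))) x * b' = b\<^sup>2 + (b' * a - b * a') / 4"
    unfolding step by (simp add: power2_eq_square field_simps)
  also have "\<dots> > 0"
    using IH by (intro add_nonneg_pos) auto
  finally show ?case by (simp add: b_def b'_def)
qed

lemma proots_pert_cheb: "proots (pert_cheb r \<mu> n) = mset_set {x. poly (pert_cheb r \<mu> n) x = 0}"
proof -
  have fin: "finite {x. poly (pert_cheb r \<mu> n) x = 0}"
    using pert_cheb_nonzero by (rule poly_roots_finite)
  have ord: "order x (pert_cheb r \<mu> n) = 1" if x: "poly (pert_cheb r \<mu> n) x = 0" for x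
  proof -
    obtain k where "n = Suc k"
      using x by (cases n) auto
    then have "poly (pderiv (pert_cheb r \<mu> n)) x \<noteq> 0"
      using pert_cheb_wronskian_pos[of r \<mu> k x] x by auto
    then have "order x (pderiv (pert_cheb r \<mu> n)) = 0"
      by (simp add: order_0I)
    then show ?thesis
      using order_pderiv[of "pert_cheb r \<mu> n" x] x pert_cheb_nonzero
      by (metis One_nat_def \<open>poly (pderiv (pert_cheb r \<mu> n)) x \<noteq> 0\<close> order_root poly_0)
  qed
  show ?thesis
    by (rule multiset_eqI)
      (use fin ord pert_cheb_nonzero in \<open>auto simp: count_mset_set' order_root\<close>)
qed

lemma zeros_in_pert_cheb:
  "zeros_in (pert_cheb r \<mu> n) S = card {x \<in> S. poly (pert_cheb r \<mu> n) x = 0}"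
proof -
  have "finite {x. poly (pert_cheb r \<mu> n) x = 0}"
    using pert_cheb_nonzero by (rule poly_roots_finite)
  then have "filter_mset (\<lambda>x. x \<in> S) (proots (pert_cheb r \<mu> n))
      = mset_set {x \<in> S. poly (pert_cheb r \<mu> n) x = 0}"
    by (simp add: proots_pert_cheb filter_mset_mset_set conj_commute)
  then show ?thesis
    by (simp add: zeros_in_def)
qed

section \<open>Factorization away from the central interval\<close>

text \<open>Perturbing by zero gives the monic Chebyshev polynomials of the second kind; the index
  \<open>0\<close> is an arbitrary choice.\<close>

abbreviation cheb :: "nat \<Rightarrow> real poly" where
  "cheb \<equiv> pert_cheb 0 0"

text \<open>The ratio \<open>cheb (k - 1) / cheb k\<close>, with \<open>cheb (-1) = 0\<close>.\<close>

primrec cheb_ratio :: "nat \<Rightarrow> real \<Rightarrow> real" where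
  "cheb_ratio 0 x = 0"
| "cheb_ratio (Suc k) x = 1 / (x - cheb_ratio k x / 4)"

text \<open>The bound \<open>2\<close> reproduces itself: for \<open>\<bar>x\<bar> \<ge> 1\<close>
  it keeps the next denominator at least \<open>1 - 2/4 = 1/2\<close> in absolute value. For
  \<open>k \<le> 1\<close> the ratio is \<open>0\<close> or \<open>1 / x\<close>, so
  \<open>\<bar>x\<bar> \<ge> 1/2\<close> suffices; the small matrices require this case.\<close>

lemma cheb_ratio_bound:
  assumes "\<bar>x\<bar> \<ge> 1/2" "k \<le> 1 \<or> \<bar>x\<bar> \<ge> 1"
  shows "\<bar>cheb_ratio k x\<bar> \<le> 2"
  using assms
proof (induction k)
  case 0
  then show ?case by simp
next
  case (Suc k)
  have "\<bar>x - cheb_ratio k x / 4\<bar> \<ge> 1/2"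
  proof (cases "k = 0")
    case False
    then have "\<bar>cheb_ratio k x\<bar> \<le> 2" "\<bar>x\<bar> \<ge> 1"
      using Suc by auto
    then show ?thesis by linarith
  qed (use Suc.prems in simp)
  then have "1 / \<bar>x - cheb_ratio k x / 4\<bar> \<le> 1 / (1/2)"
    by (intro divide_left_mono) auto
  then show ?case by simp
qed

lemma cheb_ratio_denom:
  assumes "\<bar>x\<bar> \<ge> 1/2" "Suc k \<le> 1 \<or> \<bar>x\<bar> \<ge> 1"
  shows "x - cheb_ratio k x / 4 \<noteq> 0"
proof (cases "k = 0")
  case False
  then have "\<bar>cheb_ratio k x\<bar> \<le> 2" "\<bar>x\<bar> \<ge> 1"
    using cheb_ratio_bound[of x k] assms by auto
  then show ?thesis by linarith
qed (use assms in auto)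

lemma cheb_ratio_deriv_nonpos:
  assumes "\<bar>x\<bar> \<ge> 1/2" "k \<le> 1 \<or> \<bar>x\<bar> \<ge> 1"
  shows "\<exists>D\<le>0. (cheb_ratio k has_real_derivative D) (at x)"
  using assms
proof (induction k)
  case 0
  have "cheb_ratio 0 = (\<lambda>x. 0)" by (rule ext) simp
  then show ?case by (auto intro!: exI[of _ 0])
next
  case (Suc k)
  then obtain D where D: "D \<le> 0" "(cheb_ratio k has_real_derivative D) (at x)"
    by auto
  note nz = cheb_ratio_denom[OF Suc.prems]
  have eq: "cheb_ratio (Suc k) = (\<lambda>x. 1 / (x - cheb_ratio k x / 4))" by (rule ext) simp
  have "(cheb_ratio (Suc k) has_real_derivative
      - (1 - D / 4) / (x - cheb_ratio k x / 4)\<^sup>2) (at x)"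
    unfolding eq using nz by (auto intro!: derivative_eq_intros D(2) simp: power2_eq_square)
  moreover have "- (1 - D / 4) / (x - cheb_ratio k x / 4)\<^sup>2 \<le> 0"
    using D(1) by (intro divide_nonpos_nonneg) auto
  ultimately show ?case by blast
qed

text \<open>The induction hypothesis, divided by its nonzero last factor, expresses
  \<open>cheb k\<close> through \<open>cheb (Suc k)\<close>; inserting this into the three-term
  recurrence gives the next case.\<close>

lemma poly_cheb_Suc:
  assumes "\<bar>x\<bar> \<ge> 1/2" "Suc k \<le> 1 \<or> \<bar>x\<bar> \<ge> 1"
  shows "poly (cheb (Suc k)) x = poly (cheb k) x * (x - cheb_ratio k x / 4)"
  using assms
proof (induction k)
  case 0
  then show ?case by (simp add: pert_beta_def)
next
  case (Suc k)
  have "poly (cheb (Suc k)) x = poly (cheb k) x * (x - cheb_ratio k x / 4)"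
    using Suc by auto
  moreover have "x - cheb_ratio k x / 4 \<noteq> 0"
    using Suc.prems by (intro cheb_ratio_denom) auto
  ultimately have "poly (cheb k) x = poly (cheb (Suc k)) x * cheb_ratio (Suc k) x"
    by simp
  then show ?case
    by (simp add: pert_beta_def algebra_simps del: cheb_ratio.simps)
qed

lemma poly_cheb_nonzero:
  assumes "\<bar>x\<bar> \<ge> 1/2" "k \<le> 1 \<or> \<bar>x\<bar> \<ge> 1"
  shows "poly (cheb k) x \<noteq> 0"
  using assms
proof (induction k)
  case 0
  then show ?case by simp
next
  case (Suc k)
  have "poly (cheb k) x \<noteq> 0"
    using Suc by auto
  then show ?case
    using poly_cheb_Suc[OF Suc.prems] cheb_ratio_denom[OF Suc.prems] by simp
qed

lemma poly_cheb_pred: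
  assumes "\<bar>x\<bar> \<ge> 1/2" "Suc k \<le> 1 \<or> \<bar>x\<bar> \<ge> 1"
  shows "poly (cheb k) x = poly (cheb (Suc k)) x * cheb_ratio (Suc k) x"
proof -
  have "cheb_ratio (Suc k) x * (x - cheb_ratio k x / 4) = 1"
    using cheb_ratio_denom[OF assms] by simp
  then show ?thesis
    unfolding poly_cheb_Suc[OF assms] by (metis mult.assoc mult.commute mult_1_right)
qed

section \<open>Perturbed polynomials in terms of unperturbed ones\<close>

lemma pert_cheb_eq_cheb: "k \<le> r \<Longrightarrow> pert_cheb r \<mu> k = cheb k"
proof (induction k rule: less_induct)
  case (less k)
  consider "k = 0" | "k = Suc 0" | j where "k = Suc (Suc j)"
    by (metis not0_implies_Suc)
  then show ?case
  proof cases
    case (3 j)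
    then show ?thesis using less by (simp add: pert_beta_def)
  qed (use less.prems in \<open>simp_all add: pert_beta_def\<close>)
qed

text \<open>The \<open>if\<close> encodes \<open>cheb (-1) = 0\<close>, which extends the recurrence
  to \<open>k = 0\<close>; truncated subtraction alone would yield \<open>cheb 0 = 1\<close>
  there.\<close>

lemma poly_cheb_rec:
  "poly (cheb (Suc k)) x
     = x * poly (cheb k) x - (if k = 0 then 0 else poly (cheb (k - 1)) x) / 4"
proof (cases k)
  case (Suc j)
  show ?thesis
    unfolding Suc pert_cheb.simps(3) by (simp add: pert_beta_def del: pert_cheb.simps)
qed (simp add: pert_beta_def)

text \<open>Beyond index \<open>r\<close> the recurrence is the unperturbed one, so its solution is
  a fixed combination of two unperturbed solutions with initial data at \<open>r\<close> and
  \<open>Suc r\<close>. Here \<open>m\<close> counts the rows below the perturbed row.\<close>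

lemma poly_pert_cheb_after:
  "poly (pert_cheb r \<mu> (r + m + 1)) x =
     poly (cheb m) x * poly (pert_cheb r \<mu> (Suc r)) x
       - (if m = 0 then 0 else poly (cheb (m - 1)) x) * poly (cheb r) x / 4"
proof (induction m rule: less_induct)
  case (less m)
  consider "m = 0" | "m = 1" | k where "m = Suc (Suc k)"
    by (metis One_nat_def not0_implies_Suc)
  then show ?case
  proof cases
    case 2
    then show ?thesis
      by (simp add: pert_beta_def pert_cheb_eq_cheb)
  next
    case (3 k)
    have "poly (pert_cheb r \<mu> (r + m + 1)) x = x * poly (pert_cheb r \<mu> (r + Suc k + 1)) x
        - poly (pert_cheb r \<mu> (r + k + 1)) x / 4"
      by (simp add: 3 pert_beta_def)
    also have "\<dots> = x * (poly (cheb (Suc k)) x * poly (pert_cheb r \<mu> (Suc r)) x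
          - poly (cheb k) x * poly (cheb r) x / 4)
        - (poly (cheb k) x * poly (pert_cheb r \<mu> (Suc r)) x
          - (if k = 0 then 0 else poly (cheb (k - 1)) x) * poly (cheb r) x / 4) / 4"
      using less.IH[of "Suc k"] less.IH[of k] 3 by (simp del: pert_cheb.simps)
    also have "\<dots> = (x * poly (cheb (Suc k)) x - poly (cheb k) x / 4) * poly (pert_cheb r \<mu> (Suc r)) x
        - (x * poly (cheb k) x - (if k = 0 then 0 else poly (cheb (k - 1)) x) / 4) * poly (cheb r) x / 4"
      by (simp add: field_simps del: pert_cheb.simps)
    also have "\<dots> = poly (cheb m) x * poly (pert_cheb r \<mu> (Suc r)) x
        - poly (cheb (Suc k)) x * poly (cheb r) x / 4"
      using poly_cheb_rec[of "Suc k" x] poly_cheb_rec[of k x] 3 by (simp del: pert_cheb.simps)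
    finally show ?thesis
      using 3 by (simp del: pert_cheb.simps)
  qed simp
qed

text \<open>One ratio enters at step \<open>r + 1\<close>, where \<open>\<mu>\<close> appears, and
  the other through the formula for later indices. In both places the lower-index polynomial is
  replaced by its ratio times the next one.\<close>

lemma poly_pert_cheb_factor:
  assumes "\<bar>x\<bar> \<ge> 1/2" "(r \<le> 1 \<and> m \<le> 1) \<or> \<bar>x\<bar> \<ge> 1"
  shows "poly (pert_cheb r \<mu> (r + m + 1)) x =
    poly (cheb r) x * poly (cheb m) x * (x - cheb_ratio r x / 4 - cheb_ratio m x / 4 - \<mu>)"
proof -
  have r: "poly (pert_cheb r \<mu> (Suc r)) x = poly (cheb r) x * (x - cheb_ratio r x / 4 - \<mu>)"
  proof (cases r)
    case 0
    then show ?thesis by (simp add: pert_beta_def)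
  next
    case (Suc s)
    then have "poly (cheb s) x = poly (cheb r) x * cheb_ratio r x"
      using poly_cheb_pred[of x s] assms by auto
    then show ?thesis
      using Suc by (simp add: pert_beta_def pert_cheb_eq_cheb algebra_simps
          del: cheb_ratio.simps pert_cheb.simps(3) add: pert_cheb.simps(3)[of "Suc s"])
  qed
  show ?thesis
  proof (cases m)
    case 0
    then show ?thesis using r by simp
  next
    case (Suc s)
    then have "poly (cheb s) x = poly (cheb m) x * cheb_ratio m x"
      using poly_cheb_pred[of x s] assms by auto
    then show ?thesis
      unfolding poly_pert_cheb_after r using Suc
      by (simp add: algebra_simps del: cheb_ratio.simps pert_cheb.simps)
  qed
qed

section \<open>Radii and zero counts\<close>

text \<open>With \<open>r\<close> rows above and \<open>m\<close> rows below it, the perturbed row has radius \<open>pert_radius r m\<close>;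
  \<open>free_radius r m\<close> is the largest radius of the other rows.\<close>

definition pert_radius :: "nat \<Rightarrow> nat \<Rightarrow> real" where
  "pert_radius r m = (if r = 0 then 0 else 1/2) + (if m = 0 then 0 else 1/2)"

definition free_radius :: "nat \<Rightarrow> nat \<Rightarrow> real" where
  "free_radius r m = (if r \<le> 1 \<and> m \<le> 1 then 1/2 else 1)"

lemma zeros_in_pert_cheb_separated:
  fixes r m :: nat and \<mu> :: real
  defines "n \<equiv> r + m + 1" and "d \<equiv> pert_radius r m" and "t \<equiv> free_radius r m"
  assumes gap: "\<bar>\<mu>\<bar> > t + d"
  shows "zeros_in (pert_cheb r \<mu> n) {\<mu> - d..\<mu> + d} = 1"
    and "zeros_in (pert_cheb r \<mu> n) {-t..t} = n - 1"
proof -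
  define F where "F = (\<lambda>x. x - cheb_ratio r x / 4 - cheb_ratio m x / 4 - \<mu>)"
  define I where "I = {\<mu> - d..\<mu> + d}"
  have d0: "d \<ge> 0" by (simp add: d_def pert_radius_def)
  \<comment> \<open>The value \<open>t = 1/2\<close> occurs only for \<open>r \<le> 1\<close> and
    \<open>m \<le> 1\<close>, exactly where the ratio estimates hold from \<open>1/2\<close>
    on.\<close>
  have dom: "\<bar>x\<bar> \<ge> 1/2" "(r \<le> 1 \<and> m \<le> 1) \<or> \<bar>x\<bar> \<ge> 1" if "\<bar>x\<bar> \<ge> t" for x
    using that by (auto simp: t_def free_radius_def split: if_splits)
  \<comment> \<open>Each side of the perturbed row contributes at most \<open>2/4 = 1/2\<close>, and
    nothing if it has no rows, since \<open>cheb_ratio 0\<close> vanishes. These are the summands of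
    \<open>pert_radius\<close>.\<close>
  have ratio: "\<bar>cheb_ratio r x / 4 + cheb_ratio m x / 4\<bar> \<le> d" if "\<bar>x\<bar> \<ge> t" for x
  proof -
    have "\<bar>cheb_ratio r x\<bar> \<le> (if r = 0 then 0 else 2)" "\<bar>cheb_ratio m x\<bar> \<le> (if m = 0 then 0 else 2)"
      using dom[OF that] by (auto intro!: cheb_ratio_bound)
    then show ?thesis
      by (auto simp: d_def pert_radius_def split: if_splits)
  qed
  have I_far: "\<bar>x\<bar> > t" if "x \<in> I" for x
    using that gap by (auto simp: I_def)
  have root_iff: "poly (pert_cheb r \<mu> n) x = 0 \<longleftrightarrow> F x = 0" if "\<bar>x\<bar> \<ge> t" for x
    using dom[OF that] poly_cheb_nonzero[of x r] poly_cheb_nonzero[of x m]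
    unfolding n_def F_def by (subst poly_pert_cheb_factor) auto
  have deriv: "\<exists>D>0. (F has_real_derivative D) (at x)" if x: "\<bar>x\<bar> \<ge> t" for x
  proof -
    obtain D E where "D \<le> 0" "E \<le> 0"
      and DE: "(cheb_ratio r has_real_derivative D) (at x)"
        "(cheb_ratio m has_real_derivative E) (at x)"
      using cheb_ratio_deriv_nonpos[of x r] cheb_ratio_deriv_nonpos[of x m] dom[OF x] by blast
    have "(F has_real_derivative 1 - D / 4 - E / 4) (at x)"
      unfolding F_def by (auto intro!: derivative_eq_intros DE)
    then show ?thesis
      using \<open>D \<le> 0\<close> \<open>E \<le> 0\<close> by (intro exI[of _ "1 - D / 4 - E / 4"]) auto
  qed
  have "\<exists>z\<ge>\<mu> - d. z \<le> \<mu> + d \<and> F z = 0"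
  proof (rule IVT)
    \<comment> \<open>At the endpoints \<open>x - \<mu>\<close> equals \<open>-d\<close> or
      \<open>d\<close>, which dominates the ratio terms.\<close>
    show "F (\<mu> - d) \<le> 0" "0 \<le> F (\<mu> + d)"
      using ratio[of "\<mu> - d"] ratio[of "\<mu> + d"] I_far[of "\<mu> - d"] I_far[of "\<mu> + d"] d0
      by (auto simp: F_def I_def)
    show "\<forall>x. \<mu> - d \<le> x \<and> x \<le> \<mu> + d \<longrightarrow> isCont F x"
    proof (intro allI impI)
      fix x assume "\<mu> - d \<le> x \<and> x \<le> \<mu> + d"
      then have "\<bar>x\<bar> \<ge> t" using I_far[of x] by (auto simp: I_def)
      with deriv show "isCont F x" by (blast intro: DERIV_isCont)
    qed
  qed (use d0 in simp)
  then obtain z where z: "z \<in> I" "F z = 0"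
    by (auto simp: I_def)
  have increasing: "F a < F b" if "a \<in> I" "b \<in> I" "a < b" for a b
  proof (rule DERIV_pos_imp_increasing[OF \<open>a < b\<close>])
    fix x assume "a \<le> x" "x \<le> b"
    then have "\<bar>x\<bar> \<ge> t" using that I_far[of x] by (auto simp: I_def)
    with deriv show "\<exists>D. (F has_real_derivative D) (at x) \<and> D > 0" by blast
  qed
  have "x = z" if "x \<in> I" "F x = 0" for x
    using increasing[of x z] increasing[of z x] that z by (cases x z rule: linorder_cases) auto
  moreover have "poly (pert_cheb r \<mu> n) x = 0 \<longleftrightarrow> F x = 0" if "x \<in> I" for x
    by (rule root_iff[OF less_imp_le[OF I_far[OF that]]])
  ultimately have "{x \<in> I. poly (pert_cheb r \<mu> n) x = 0} = {z}"
    using z by blast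
  then show one: "zeros_in (pert_cheb r \<mu> n) {\<mu> - d..\<mu> + d} = 1"
    unfolding zeros_in_pert_cheb I_def by simp
  have loc: "x \<in> {-t..t} \<longleftrightarrow> x \<notin> I" if "poly (pert_cheb r \<mu> n) x = 0" for x
  proof
    show "x \<notin> I" if "x \<in> {-t..t}"
      using that I_far[of x] by auto
    show "x \<in> {-t..t}" if "x \<notin> I"
    proof (rule ccontr)
      assume "x \<notin> {-t..t}"
      then have "\<bar>x\<bar> \<ge> t" by auto
      then have "F x = 0"
        using root_iff \<open>poly (pert_cheb r \<mu> n) x = 0\<close> by blast
      \<comment> \<open>A zero of \<open>F\<close> satisfies
        \<open>x - \<mu> = cheb_ratio r x / 4 + cheb_ratio m x / 4\<close>, so it lies within
        \<open>d\<close> of \<open>\<mu>\<close>.\<close>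
      with ratio[OF \<open>\<bar>x\<bar> \<ge> t\<close>] have "x \<in> I"
        by (auto simp: F_def I_def)
      with that show False ..
    qed
  qed
  let ?M = "proots (pert_cheb r \<mu> n)"
  \<comment> \<open>The zeros in the central interval are those outside \<open>I\<close>; as there
    are \<open>n\<close> real zeros in total, removing the one in \<open>I\<close> gives their
    number.\<close>
  have "filter_mset (\<lambda>x. x \<in> {-t..t}) ?M = filter_mset (\<lambda>x. x \<notin> I) ?M"
    using loc pert_cheb_nonzero by (intro filter_mset_cong) auto
  moreover have "size (filter_mset (\<lambda>x. x \<in> I) ?M) + size (filter_mset (\<lambda>x. x \<notin> I) ?M) = n"
    by (metis multiset_partition size_union size_proots_pert_cheb)
  ultimately show "zeros_in (pert_cheb r \<mu> n) {-t..t} = n - 1"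
    using one by (simp add: zeros_in_def I_def)
qed

section \<open>The union of the Gershgorin intervals\<close>

text \<open>Row \<open>i\<close> has \<open>i\<close> rows above and \<open>n - Suc i\<close> below;
  each neighbour that exists contributes \<open>1/2\<close>.\<close>

lemma gershgorin_radius_pert_jacobi:
  assumes "i < n"
  shows "gershgorin_radius (pert_jacobi r \<mu> n) i = pert_radius i (n - Suc i)"
proof -
  have "gershgorin_radius (pert_jacobi r \<mu> n) i
      = (\<Sum>j \<in> {..<n} - {i}. if j \<in> {j. i = Suc j \<or> j = Suc i} then 1/2 else 0)"
    unfolding gershgorin_radius_def using assms
    by (intro sum.cong) (auto simp: pert_jacobi_def)
  also have "\<dots> = (\<Sum>j \<in> ({..<n} - {i}) \<inter> {j. i = Suc j \<or> j = Suc i}. 1/2)"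
    by (rule sum.inter_restrict[symmetric]) simp
  also have "({..<n} - {i}) \<inter> {j. i = Suc j \<or> j = Suc i}
      = (if i = 0 then {} else {i - 1}) \<union> (if n - Suc i = 0 then {} else {Suc i})"
    using assms by auto
  also have "(\<Sum>j \<in> \<dots>. 1/2) = pert_radius i (n - Suc i)"
    by (auto simp: pert_radius_def)
  finally show ?thesis .
qed

lemma pert_dom_eq_UN:
  "pert_dom r \<mu> n =
     (\<Union>i<n. {pert_beta r \<mu> i - pert_radius i (n - Suc i)..pert_beta r \<mu> i + pert_radius i (n - Suc i)})"
proof -
  have "dim_row (pert_jacobi r \<mu> n) = n"
    by (simp add: pert_jacobi_def)
  moreover have "pert_jacobi r \<mu> n $$ (i, i) = pert_beta r \<mu> i" if "i < n" for i
    using that by (simp add: pert_jacobi_def)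
  ultimately show ?thesis
    by (simp add: gershgorin_union_def gershgorin_interval_def gershgorin_radius_pert_jacobi)
qed

text \<open>The centres \<open>0\<close> and \<open>\<mu>\<close> are at most the sum of the
  half-lengths apart, so the intervals meet and leave no gap.\<close>

lemma Icc_Un_Icc_symmetric:
  fixes t d \<mu> :: real
  assumes "0 \<le> t" "0 \<le> d" "\<bar>\<mu>\<bar> \<le> t + d"
  shows "{-t..t} \<union> {\<mu> - d..\<mu> + d} = {min (-t) (\<mu> - d)..max t (\<mu> + d)}"
proof (rule Set.set_eqI)
  fix x
  show "x \<in> {-t..t} \<union> {\<mu> - d..\<mu> + d} \<longleftrightarrow> x \<in> {min (-t) (\<mu> - d)..max t (\<mu> + d)}"
    unfolding Un_iff atLeastAtMost_iff min_le_iff_disj le_max_iff_disj using assms by linarith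
qed

text \<open>All unperturbed rows have intervals centred at \<open>0\<close>, so these are nested and
  their union is the largest one. The assumption \<open>n \<ge> 2\<close> provides such a
  row.\<close>

lemma pert_dom_eq:
  assumes "n = r + m + 1" "n \<ge> 2"
  shows "pert_dom r \<mu> n =
    {- free_radius r m..free_radius r m} \<union> {\<mu> - pert_radius r m..\<mu> + pert_radius r m}"
proof -
  let ?J = "\<lambda>i. {- pert_radius i (n - Suc i)..pert_radius i (n - Suc i)}"
  have "pert_dom r \<mu> n = (\<Union>i\<in>{..<n} - {r}. ?J i) \<union> {\<mu> - pert_radius r m..\<mu> + pert_radius r m}"
    using assms unfolding pert_dom_eq_UN by (fastforce simp: pert_beta_def split: if_splits)
  moreover have "(\<Union>i\<in>{..<n} - {r}. ?J i) = {- free_radius r m..free_radius r m}"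
  proof
    show "(\<Union>i\<in>{..<n} - {r}. ?J i) \<subseteq> {- free_radius r m..free_radius r m}"
      using assms by (fastforce simp: pert_radius_def free_radius_def split: if_splits)
    \<comment> \<open>A row of largest radius other than \<open>r\<close>: for
      \<open>r \<ge> 2\<close> row \<open>1\<close> has two neighbours, for \<open>m \<ge> 2\<close>
      row \<open>r + 1\<close> does. Otherwise every remaining row is an end row of radius
      \<open>1/2\<close>.\<close>
    define i where "i = (if r \<ge> 2 then 1 else if m \<ge> 2 then r + 1 else if r = 0 then 1 else 0)"
    have "i \<in> {..<n} - {r}" "?J i = {- free_radius r m..free_radius r m}"
      using assms by (auto simp: i_def pert_radius_def free_radius_def)
    then show "{- free_radius r m..free_radius r m} \<subseteq> (\<Union>i\<in>{..<n} - {r}. ?J i)"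
      by blast
  qed
  ultimately show ?thesis by simp
qed

section \<open>Assembling the cases of \<open>r\<close> and \<open>n\<close>\<close>

theorem proposition5p1:
  fixes r n :: nat and \<mu> :: real
  assumes "\<mu> \<noteq> 0"
  shows "(r = 0 \<longrightarrow>
         (n = 1 \<longrightarrow> pert_dom r \<mu> n = {\<mu>}) \<and>
         (n = 2 \<longrightarrow>
           (-1 \<le> \<mu> \<and> \<mu> < 0 \<longrightarrow> pert_dom r \<mu> n = {\<mu> - 1/2..1/2}) \<and>
           (0 < \<mu> \<and> \<mu> \<le> 1 \<longrightarrow> pert_dom r \<mu> n = {-1/2..\<mu> + 1/2}) \<and>
           (\<mu> > 1 \<or> \<mu> < -1 \<longrightarrow>
             {-1/2..1/2} \<inter> {\<mu> - 1/2..\<mu> + 1/2} = {} \<and>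
             zeros_in (pert_cheb r \<mu> n) {\<mu> - 1/2..\<mu> + 1/2} = 1 \<and>
             zeros_in (pert_cheb r \<mu> n) {-1/2..1/2} = 1)) \<and>
         (n \<ge> 3 \<longrightarrow>
           (-3/2 \<le> \<mu> \<and> \<mu> \<le> -1/2 \<longrightarrow> pert_dom r \<mu> n = {\<mu> - 1/2..1}) \<and>
           (-1/2 \<le> \<mu> \<and> \<mu> \<le> 1/2 \<longrightarrow> pert_dom r \<mu> n = {-1..1}) \<and>
           (1/2 \<le> \<mu> \<and> \<mu> \<le> 3/2 \<longrightarrow> pert_dom r \<mu> n = {-1..\<mu> + 1/2}) \<and>
           (\<mu> > 3/2 \<or> \<mu> < -3/2 \<longrightarrow>
             {-1..1} \<inter> {\<mu> - 1/2..\<mu> + 1/2} = {} \<and>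
             zeros_in (pert_cheb r \<mu> n) {\<mu> - 1/2..\<mu> + 1/2} = 1 \<and>
             zeros_in (pert_cheb r \<mu> n) {-1..1} = n - 1))) \<and>
       (r = 1 \<longrightarrow>
         (n = 2 \<longrightarrow>
           (-1 \<le> \<mu> \<and> \<mu> < 0 \<longrightarrow> pert_dom r \<mu> n = {\<mu> - 1/2..1/2}) \<and>
           (0 < \<mu> \<and> \<mu> \<le> 1 \<longrightarrow> pert_dom r \<mu> n = {-1/2..\<mu> + 1/2}) \<and>
           (\<mu> > 1 \<or> \<mu> < -1 \<longrightarrow>
             {-1/2..1/2} \<inter> {\<mu> - 1/2..\<mu> + 1/2} = {} \<and>
             zeros_in (pert_cheb r \<mu> n) {\<mu> - 1/2..\<mu> + 1/2} = 1 \<and>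
             zeros_in (pert_cheb r \<mu> n) {-1/2..1/2} = 1)) \<and>
         (n = 3 \<longrightarrow>
           (-3/2 \<le> \<mu> \<and> \<mu> \<le> -1/2 \<longrightarrow> pert_dom r \<mu> n = {\<mu> - 1..1/2}) \<and>
           (-1/2 \<le> \<mu> \<and> \<mu> \<le> 1/2 \<longrightarrow> pert_dom r \<mu> n = {\<mu> - 1..\<mu> + 1}) \<and>
           (1/2 \<le> \<mu> \<and> \<mu> \<le> 3/2 \<longrightarrow> pert_dom r \<mu> n = {-1/2..\<mu> + 1}) \<and>
           (\<mu> > 3/2 \<or> \<mu> < -3/2 \<longrightarrow>
             {-1/2..1/2} \<inter> {\<mu> - 1..\<mu> + 1} = {} \<and>
             zeros_in (pert_cheb r \<mu> n) {\<mu> - 1..\<mu> + 1} = 1 \<and>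
             zeros_in (pert_cheb r \<mu> n) {-1/2..1/2} = n - 1)) \<and>
         (n \<ge> 4 \<longrightarrow>
           (-2 \<le> \<mu> \<and> \<mu> < 0 \<longrightarrow> pert_dom r \<mu> n = {\<mu> - 1..1}) \<and>
           (0 < \<mu> \<and> \<mu> \<le> 2 \<longrightarrow> pert_dom r \<mu> n = {-1..\<mu> + 1}) \<and>
           (\<mu> > 2 \<or> \<mu> < -2 \<longrightarrow>
             {-1..1} \<inter> {\<mu> - 1..\<mu> + 1} = {} \<and>
             zeros_in (pert_cheb r \<mu> n) {\<mu> - 1..\<mu> + 1} = 1 \<and>
             zeros_in (pert_cheb r \<mu> n) {-1..1} = n - 1))) \<and>
       (r \<ge> 2 \<longrightarrow>
         (n = r + 1 \<longrightarrow>
           (-3/2 \<le> \<mu> \<and> \<mu> \<le> -1/2 \<longrightarrow> pert_dom r \<mu> n = {\<mu> - 1/2..1}) \<and>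
           (-1/2 \<le> \<mu> \<and> \<mu> \<le> 1/2 \<longrightarrow> pert_dom r \<mu> n = {-1..1}) \<and>
           (1/2 \<le> \<mu> \<and> \<mu> \<le> 3/2 \<longrightarrow> pert_dom r \<mu> n = {-1..\<mu> + 1/2}) \<and>
           (\<mu> > 3/2 \<or> \<mu> < -3/2 \<longrightarrow>
             {-1..1} \<inter> {\<mu> - 1/2..\<mu> + 1/2} = {} \<and>
             zeros_in (pert_cheb r \<mu> n) {\<mu> - 1/2..\<mu> + 1/2} = 1 \<and>
             zeros_in (pert_cheb r \<mu> n) {-1..1} = n - 1)) \<and>
         (n \<ge> r + 2 \<longrightarrow>
           (-2 \<le> \<mu> \<and> \<mu> < 0 \<longrightarrow> pert_dom r \<mu> n = {\<mu> - 1..1}) \<and>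
           (0 < \<mu> \<and> \<mu> \<le> 2 \<longrightarrow> pert_dom r \<mu> n = {-1..\<mu> + 1}) \<and>
           (\<mu> > 2 \<or> \<mu> < -2 \<longrightarrow>
             {-1..1} \<inter> {\<mu> - 1..\<mu> + 1} = {} \<and>
             zeros_in (pert_cheb r \<mu> n) {\<mu> - 1..\<mu> + 1} = 1 \<and>
             zeros_in (pert_cheb r \<mu> n) {-1..1} = n - 1)))"
proof -
  have zeros: "{- free_radius r m..free_radius r m} \<inter> {\<mu> - pert_radius r m..\<mu> + pert_radius r m} = {}
      \<and> zeros_in (pert_cheb r \<mu> n) {\<mu> - pert_radius r m..\<mu> + pert_radius r m} = 1
      \<and> zeros_in (pert_cheb r \<mu> n) {- free_radius r m..free_radius r m} = n - 1"
    if "n = r + m + 1" "\<bar>\<mu>\<bar> > free_radius r m + pert_radius r m" for m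
    using zeros_in_pert_cheb_separated[OF that(2)] that by auto
  have single: "pert_dom r \<mu> n = {\<mu>}" if "r = 0" "n = 1"
    using that by (simp add: pert_dom_eq_UN pert_beta_def pert_radius_def lessThan_Suc)
  show ?thesis
  proof (cases "n \<ge> 2 \<and> n \<ge> r + 1")
    case False
    \<comment> \<open>Outside \<open>n \<ge> 2\<close> and \<open>n \<ge> r + 1\<close>, the only
      claim with satisfiable premises is the one for \<open>r = 0\<close>,
      \<open>n = 1\<close>.\<close>
    then show ?thesis using single by auto
  next
    case True
    define m where "m = n - r - 1"
    have n: "n = r + m + 1" "n \<ge> 2"
      using True by (auto simp: m_def)
    have overlap: "pert_dom r \<mu> n =
        {min (- free_radius r m) (\<mu> - pert_radius r m)..max (free_radius r m) (\<mu> + pert_radius r m)}"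
      if "\<bar>\<mu>\<bar> \<le> free_radius r m + pert_radius r m"
      unfolding pert_dom_eq[OF n]
      by (rule Icc_Un_Icc_symmetric) (use that in \<open>auto simp: free_radius_def pert_radius_def\<close>)
    note facts = overlap zeros[OF n(1)]
    \<comment> \<open>Both radii are constant on each of these seven ranges; the position of
      \<open>\<mu>\<close> then decides the \<open>min\<close> and \<open>max\<close> in
      \<open>overlap\<close>.\<close>
    consider "r = 0" "m = 1" | "r = 0" "m \<ge> 2" | "r = 1" "m = 0" | "r = 1" "m = 1"
      | "r = 1" "m \<ge> 2" | "r \<ge> 2" "m = 0" | "r \<ge> 2" "m \<ge> 1"
      using n by linarith
    then show ?thesis
    proof cases
      case 1 then show ?thesis using facts n(1) assms
        by (simp add: free_radius_def pert_radius_def min_def max_def)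
    next
      case 2 then show ?thesis using facts n(1) assms
        by (simp add: free_radius_def pert_radius_def min_def max_def)
    next
      case 3 then show ?thesis using facts n(1) assms
        by (simp add: free_radius_def pert_radius_def min_def max_def)
    next
      case 4 then show ?thesis using facts n(1) assms
        by (simp add: free_radius_def pert_radius_def min_def max_def)
    next
      case 5 then show ?thesis using facts n(1) assms
        by (simp add: free_radius_def pert_radius_def min_def max_def)
    next
      case 6 then show ?thesis using facts n(1) assms
        by (simp add: free_radius_def pert_radius_def min_def max_def)
    next
      case 7 then show ?thesis using facts n(1) assms
        by (simp add: free_radius_def pert_radius_def min_def max_def)
    qed
  qed
qed

end
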